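(* Let $R$ be a finite local ring, and let $B_0$ be a $\parallel$-transversal subset of the projective line $\mathbb{P}(R)$ with $k\geq 3$ points. Put $\mathcal{B}:=B_0^{\mathrm{GL}_2(R)}=\{B_0^\gamma\mid\gamma\in \mathrm{GL}_2(R)\}$. Then $(\mathbb{P}(R),\mathcal{B},\parallel)$ is a $3$-$(s,k,\lambda_3)$-divisible design (for some positive integer $\lambda_3$) with $v=\# R+\#\,\mathrm{rad}\,R$ points, and $s=\#\,\mathrm{rad}\,R$.
   Context: Rings are associative with $1\neq 0$; $R^*$ is the group of units of $R$. A ring $R$ is local if $R\setminus R^*$ is a (two-sided) ideal; then $\mathrm{rad}\,R=R\setminus R^*$ is the Jacobson radical. The group $\mathrm{GL}_2(R)$ acts on the free left $R$-module $R^2$ of row vectors by right multiplication. The projective line is the orbit $\mathbb{P}(R):=(R(1,0))^{\mathrm{GL}_2(R)}$ of the submodule $R(1,0)$; its elements are called points. The distant relation on $\mathbb{P}(R)$ is the orbit of the pair $(R(1,0),R(0,1))$ under $\mathrm{GL}_2(R)$. For a local ring $R$, two points are called parallel, $p\parallel q$, if they are not distant; for local $R$ this is an equivalence relation on $\mathbb{P}(R)$. Divisible designs: let $X$ be a finite set with an equivalence relation $\mathcal{R}$, let $[x]$ be the class of $x\in X$, let $\mathcal{S}$ be the set of all classes, and let $v:=\# X$. A subset of $X$ is $\mathcal{R}$-transversal if it meets each class in at most one element. A triple $(X,\mathcal{B},\mathcal{S})$, also written $(X,\mathcal{B},\mathcal{R})$, is a $t$-$(s,k,\lambda_t)$-divisible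 design if $t,s,k,\lambda_t$ are positive integers such that: (A) $\mathcal{B}$ is a set of $\mathcal{R}$-transversal subsets of $X$ (blocks), each with $k$ elements; (B) $\#[x]=s$ for all $x\in X$; (C) each $\mathcal{R}$-transversal $t$-subset of $X$ is contained in exactly $\lambda_t$ elements of $\mathcal{B}$; (D) $t\leq v/s$. *)

theory Defs
  imports "HOL-Analysis.Analysis"
begin

section \<open>Not necessarily commutative local rings\<close>

definition ring_units :: "'a::ring_1 set" where
  "ring_units = {x. \<exists>y. x * y = 1 \<and> y * x = 1}"

definition left_ideal :: "'a::ring_1 set \<Rightarrow> bool" where
  "left_ideal I \<longleftrightarrow>
     0 \<in> I \<and> (\<forall>x\<in>I. \<forall>y\<in>I. x - y \<in> I) \<and> (\<forall>r. \<forall>x\<in>I. r * x \<in> I)"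

definition two_sided_ideal :: "'a::ring_1 set \<Rightarrow> bool" where
  "two_sided_ideal I \<longleftrightarrow> left_ideal I \<and> (\<forall>r. \<forall>x\<in>I. x * r \<in> I)"

definition local_ring :: "'a::ring_1 itself \<Rightarrow> bool" where
  "local_ring _ \<longleftrightarrow> two_sided_ideal (- ring_units :: 'a set)"

definition maximal_left_ideal :: "'a::ring_1 set \<Rightarrow> bool" where
  "maximal_left_ideal M \<longleftrightarrow>
     left_ideal M \<and> M \<noteq> UNIV \<and> (\<forall>I. left_ideal I \<longrightarrow> M \<subseteq> I \<longrightarrow> I = M \<or> I = UNIV)"

definition jacobson_radical :: "'a::ring_1 set" where
  "jacobson_radical = \<Inter>{M. maximal_left_ideal M}"

lemma left_ideal_unit_eq_UNIV:
  assumes "left_ideal I" "u \<in> I" "u \<in> ring_units"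
  shows "I = UNIV"
proof -
  obtain w where w: "w * u = 1"
    using assms(3) by (auto simp: ring_units_def)
  have "x \<in> I" for x
  proof -
    have "(x * w) * u \<in> I"
      using assms(1,2) by (auto simp: left_ideal_def)
    then show ?thesis
      by (simp add: mult.assoc w)
  qed
  then show ?thesis by blast
qed

lemma jacobson_radical_local_ring:
  assumes "local_ring TYPE('a::ring_1)"
  shows "(jacobson_radical :: 'a set) = - ring_units"
proof -
  let ?N = "- ring_units :: 'a set"
  have N: "left_ideal ?N"
    using assms by (simp add: local_ring_def two_sided_ideal_def)
  have one: "1 \<in> (ring_units :: 'a set)"
    by (auto simp: ring_units_def)
  have sub: "I \<subseteq> ?N" if "left_ideal I" "I \<noteq> UNIV" for I :: "'a set"
    using that left_ideal_unit_eq_UNIV by blast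
  have "maximal_left_ideal M \<longleftrightarrow> M = ?N" for M :: "'a set"
    unfolding maximal_left_ideal_def using N one sub by blast
  then show ?thesis
    by (simp add: jacobson_radical_def)
qed

section \<open>The projective line over a ring\<close>

text \<open>
  Row vectors are multiplied by matrices from the right. Both \<open>(**)\<close> and \<open>(v*)\<close>
  keep the order of the factors, so they are the right operations over a
  noncommutative ring.
\<close>

definition GL2 :: "('a::ring_1 ^ 2 ^ 2) set" where
  "GL2 = {g. invertible g}"

definition left_span :: "'a::ring_1 ^ 2 \<Rightarrow> ('a ^ 2) set" where
  "left_span v = range (\<lambda>r. r *s v)"

definition act :: "('a::ring_1 ^ 2) set \<Rightarrow> 'a ^ 2 ^ 2 \<Rightarrow> ('a ^ 2) set" where
  "act p g = (\<lambda>v. v v* g) ` p"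

definition projective_line :: "('a::ring_1 ^ 2) set set" where
  "projective_line = {act (left_span (vector [1, 0])) g | g. g \<in> GL2}"

definition distant :: "('a::ring_1 ^ 2) set rel" where
  "distant = {(act (left_span (vector [1, 0])) g, act (left_span (vector [0, 1])) g) | g. g \<in> GL2}"

definition parallel :: "('a::ring_1 ^ 2) set rel" where
  "parallel = {(p, q). p \<in> projective_line \<and> q \<in> projective_line \<and> (p, q) \<notin> distant}"

definition block_orbit :: "('a::ring_1 ^ 2) set set \<Rightarrow> ('a ^ 2) set set set" where
  "block_orbit B0 = {(\<lambda>p. act p g) ` B0 | g. g \<in> GL2}"

section \<open>Divisible designs\<close>

definition transversal :: "'b set \<Rightarrow> 'b rel \<Rightarrow> 'b set \<Rightarrow> bool" where
  "transversal X E Y \<longleftrightarrow> Y \<subseteq> X \<and> (\<forall>C \<in> X // E. \<exists>\<^sub>\<le>\<^sub>1 y. y \<in> Y \<inter> C)"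

definition divisible_design ::
    "nat \<Rightarrow> nat \<Rightarrow> nat \<Rightarrow> nat \<Rightarrow> 'b set \<Rightarrow> 'b set set \<Rightarrow> 'b rel \<Rightarrow> bool" where
  "divisible_design t s k l X \<B> E \<longleftrightarrow>
     finite X \<and> equiv X E \<and> 0 < t \<and> 0 < s \<and> 0 < k \<and> 0 < l \<and>
     (\<forall>B\<in>\<B>. transversal X E B \<and> card B = k) \<and>
     (\<forall>x\<in>X. card (E `` {x}) = s) \<and>
     (\<forall>T. transversal X E T \<and> card T = t \<longrightarrow> card {B\<in>\<B>. T \<subseteq> B} = l) \<and>
     real t \<le> real (card X) / real s"

end

theory Submission
  imports Defs
begin

text \<open>
  A group of symmetries of a finite set with an equivalence relation turns any transversal set
  \<open>B\<^sub>0\<close> with at least \<open>t\<close> elements into a divisible design, as soon as it is transitive on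
  points and on transversal \<open>t\<close>-subsets: the blocks are the images of \<open>B\<^sub>0\<close>, and a symmetry
  moving one transversal \<open>t\<close>-subset to another matches the blocks through the first with the
  blocks through the second, so their number is constant. This construction of Spera is
  \<open>orbit_is_divisible_design\<close>.

  It remains to see that \<open>GL2\<close> acts in this way on the projective line over a local ring \<open>R\<close>,
  with \<open>t = 3\<close>. Parallel means not distant, so a transversal \<open>3\<close>-subset consists of three
  pairwise distant points. By definition of the distant relation, the first two can be moved to
  \<open>R(1,0)\<close> and \<open>R(0,1)\<close>. A point distant from both of these has the form \<open>R(1,d)\<close> with \<open>d\<close> a
  unit, and the matrix \<open>diag(1,d)\<close> fixes the two points and takes \<open>R(1,1)\<close> to it. Hence all
  ordered triples of pairwise distant points form one orbit
  (\<open>GL2_transitive_on_distant_triples\<close>).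

  The same use of transitivity on points reduces every statement about the parallel relation to
  the point \<open>R(1,0)\<close>: its class consists of the points \<open>R(1,b)\<close> with \<open>b\<close> a nonunit, which gives
  the class size and, because differences of nonunits are nonunits, also the transitivity of the
  relation (\<open>parallel_class_base\<close>, \<open>equiv_parallel\<close>). Finally, some entry of the first row of an
  invertible matrix over a local ring is a unit, so the points are the \<open>R(1,b)\<close> for arbitrary
  \<open>b\<close> and the \<open>R(a,1)\<close> for nonunits \<open>a\<close>, without repetition. Counting them gives the size of the
  line.

  The ring may be noncommutative, so there are no determinants; invertibility of a \<open>2 \<times> 2\<close> matrix
  is always read off from the equations that an explicit inverse satisfies.
\<close>

section \<open>Divisible designs from group actions\<close>

lemma transversal_iff_inequivalent:
  assumes "equiv X E"
  shows "transversal X E Y \<longleftrightarrow> Y \<subseteq> X \<and> (\<forall>x\<in>Y. \<forall>y\<in>Y. (x, y) \<in> E \<longrightarrow> x = y)"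
proof -
  have "(\<forall>C \<in> X // E. \<exists>\<^sub>\<le>\<^sub>1 y. y \<in> Y \<inter> C) \<longleftrightarrow> (\<forall>x\<in>Y. \<forall>y\<in>Y. (x, y) \<in> E \<longrightarrow> x = y)"
    if "Y \<subseteq> X"
  proof (intro iffI ballI impI)
    fix x y
    assume *: "\<forall>C \<in> X // E. \<exists>\<^sub>\<le>\<^sub>1 y. y \<in> Y \<inter> C" and "x \<in> Y" "y \<in> Y" "(x, y) \<in> E"
    moreover from this that have "E `` {x} \<in> X // E" "x \<in> E `` {x}"
      using assms by (auto intro: quotientI dest: equiv_class_self[of X E x])
    ultimately show "x = y"
      unfolding Uniq_def by blast
  next
    fix C
    assume "\<forall>x\<in>Y. \<forall>y\<in>Y. (x, y) \<in> E \<longrightarrow> x = y" and "C \<in> X // E"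
    then show "\<exists>\<^sub>\<le>\<^sub>1 y. y \<in> Y \<inter> C"
      unfolding Uniq_def by (metis IntD1 IntD2 assms in_quotient_imp_in_rel insert_subset empty_subsetI)
  qed
  then show ?thesis
    by (simp add: transversal_def cong: conj_cong)
qed

text \<open>
  The elements of \<open>G\<close> are bijections of the whole type that stabilise \<open>X\<close>. In this form the group
  axioms are plain equations between functions, and the action of \<open>GL2\<close> satisfies them because it
  is defined on arbitrary sets of vectors.
\<close>

locale equivalence_automorphism_group =
  fixes X :: "'b set" and E :: "'b rel" and G :: "('b \<Rightarrow> 'b) set"
  assumes finite_X: "finite X"
    and equiv_E: "equiv X E"
    and id_mem: "id \<in> G"
    and comp_mem: "f \<in> G \<Longrightarrow> g \<in> G \<Longrightarrow> f \<circ> g \<in> G"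
    and inverse_mem: "f \<in> G \<Longrightarrow> \<exists>g\<in>G. g \<circ> f = id \<and> f \<circ> g = id"
    and preserves_E: "f \<in> G \<Longrightarrow> (x, y) \<in> E \<Longrightarrow> (f x, f y) \<in> E"
begin

lemma inj_mem: "f \<in> G \<Longrightarrow> inj f"
  by (metis inj_on_id inj_on_imageI2 inverse_mem)

lemma preserves_X: "f \<in> G \<Longrightarrow> x \<in> X \<Longrightarrow> f x \<in> X"
  using equiv_E preserves_E[of f x x] by (auto simp: equiv_class_eq_iff)

lemma preserves_E_iff:
  assumes "f \<in> G"
  shows "(f x, f y) \<in> E \<longleftrightarrow> (x, y) \<in> E"
proof -
  obtain g where "g \<in> G" and "g \<circ> f = id"
    using inverse_mem[OF assms] by blast
  then show ?thesis
    using preserves_E[of g "f x" "f y"] preserves_E[OF assms] by (auto simp: fun_eq_iff)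
qed

lemma class_image:
  assumes "f \<in> G"
  shows "E `` {f x} = f ` (E `` {x})"
proof -
  obtain g where "f \<circ> g = id"
    using inverse_mem[OF assms] by blast
  then have surj: "y = f (g y)" for y
    by (simp add: fun_eq_iff)
  show ?thesis
  proof (intro equalityI subsetI)
    fix y assume "y \<in> E `` {f x}"
    then have "(f x, f (g y)) \<in> E"
      using surj[of y] by simp
    then have "g y \<in> E `` {x}"
      by (simp add: preserves_E_iff[OF assms])
    then show "y \<in> f ` (E `` {x})"
      using surj[of y] by blast
  qed (auto simp: preserves_E[OF assms])
qed

lemma transversal_image:
  assumes "f \<in> G" "transversal X E Y"
  shows "transversal X E (f ` Y)"
  using assms preserves_X preserves_E_iff[OF assms(1)]
  unfolding transversal_iff_inequivalent[OF equiv_E] by auto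

text \<open>
  Taking images under \<open>f\<close> permutes the orbit of \<open>B0\<close> and carries the blocks through \<open>T\<close> onto the
  blocks through \<open>f ` T\<close>; the inverse of \<open>f\<close> undoes this.
\<close>

lemma card_blocks_through_image:
  assumes "f \<in> G"
  shows "card {B \<in> {g ` B0 |g. g \<in> G}. f ` T \<subseteq> B} = card {B \<in> {g ` B0 |g. g \<in> G}. T \<subseteq> B}"
proof -
  obtain f' where f': "f' \<in> G" and inv: "f' \<circ> f = id" "f \<circ> f' = id"
    using inverse_mem[OF assms] by blast
  have orbit: "h ` B \<in> {g ` B0 |g. g \<in> G}" if "h \<in> G" "B \<in> {g ` B0 |g. g \<in> G}" for h B
    using that comp_mem by (auto simp flip: image_comp) (metis image_comp)
  have "bij_betw ((`) f) {B \<in> {g ` B0 |g. g \<in> G}. T \<subseteq> B} {B \<in> {g ` B0 |g. g \<in> G}. f ` T \<subseteq> B}"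
  proof (rule bij_betw_byWitness[where f' = "(`) f'"])
    show "(`) f ` {B \<in> {g ` B0 |g. g \<in> G}. T \<subseteq> B} \<subseteq> {B \<in> {g ` B0 |g. g \<in> G}. f ` T \<subseteq> B}"
      using orbit[OF assms] by blast
    show "(`) f' ` {B \<in> {g ` B0 |g. g \<in> G}. f ` T \<subseteq> B} \<subseteq> {B \<in> {g ` B0 |g. g \<in> G}. T \<subseteq> B}"
    proof (rule image_subsetI)
      fix B assume B: "B \<in> {B \<in> {g ` B0 |g. g \<in> G}. f ` T \<subseteq> B}"
      have "T = f' ` f ` T"
        by (simp add: image_comp inv)
      also have "\<dots> \<subseteq> f' ` B"
        using B by (intro image_mono) simp
      finally show "f' ` B \<in> {B \<in> {g ` B0 |g. g \<in> G}. T \<subseteq> B}"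
        using orbit[OF f'] B by blast
    qed
  qed (simp_all add: image_comp inv)
  then show ?thesis
    by (simp add: bij_betw_same_card)
qed

text \<open>
  The classes of the elements of a transversal set are pairwise disjoint. This yields the
  requirement \<open>t \<le> v / s\<close> on the parameters of a design.
\<close>

lemma card_transversal_times_class_le:
  assumes "transversal X E Y" and "\<And>x. x \<in> X \<Longrightarrow> card (E `` {x}) = s"
  shows "card Y * s \<le> card X"
proof -
  have Y: "Y \<subseteq> X" and inequivalent: "\<And>x y. x \<in> Y \<Longrightarrow> y \<in> Y \<Longrightarrow> (x, y) \<in> E \<Longrightarrow> x = y"
    using assms(1) unfolding transversal_iff_inequivalent[OF equiv_E] by auto
  have sub: "E `` {x} \<subseteq> X" for x
    using equiv_E by (auto simp: equiv_class_eq_iff)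
  have "card (\<Union>x\<in>Y. E `` {x}) = (\<Sum>x\<in>Y. card (E `` {x}))"
  proof (rule card_UN_disjoint)
    show "\<forall>x\<in>Y. \<forall>y\<in>Y. x \<noteq> y \<longrightarrow> E `` {x} \<inter> E `` {y} = {}"
    proof (intro ballI impI)
      fix x y assume "x \<in> Y" "y \<in> Y" "x \<noteq> y"
      then have "(x, y) \<notin> E"
        using inequivalent by blast
      then show "E `` {x} \<inter> E `` {y} = {}"
        using equiv_class_nondisjoint[OF equiv_E, of _ x y] by blast
    qed
    show "finite Y" "\<forall>x\<in>Y. finite (E `` {x})"
      using finite_subset[OF Y finite_X] finite_subset[OF sub finite_X] by auto
  qed
  also have "\<dots> = card Y * s"
    using assms(2) Y by (simp add: subset_iff)
  finally show ?thesis
    using sub finite_X by (metis (no_types, lifting) UN_least card_mono)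
qed

text \<open>
  All transversal \<open>t\<close>-subsets are images of \<open>T0\<close>, hence lie in equally many blocks. This number is
  positive because \<open>B0\<close> itself contains a transversal \<open>t\<close>-subset. All classes are images of the
  class of \<open>x0\<close>, hence equally large.
\<close>

theorem orbit_is_divisible_design:
  assumes transitive: "\<And>x. x \<in> X \<Longrightarrow> \<exists>f\<in>G. f x0 = x"
    and homogeneous: "\<And>T. transversal X E T \<Longrightarrow> card T = t \<Longrightarrow> \<exists>f\<in>G. f ` T0 = T"
    and B0: "transversal X E B0" and "0 < t" "t \<le> card B0"
  shows "\<exists>l. divisible_design t (card (E `` {x0})) (card B0) l X {f ` B0 |f. f \<in> G} E"
proof -
  let ?\<B> = "{f ` B0 |f. f \<in> G}"
  define l where "l = card {B \<in> ?\<B>. T0 \<subseteq> B}"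
  have blocks: "transversal X E B \<and> card B = card B0" if "B \<in> ?\<B>" for B
    using that B0 transversal_image inj_mem by (auto intro!: card_image inj_on_subset[OF inj_mem])
  have B0_mem: "B0 \<in> ?\<B>"
    using id_mem by (force intro: exI[of _ id])
  have classes: "card (E `` {x}) = card (E `` {x0})" if x: "x \<in> X" for x
  proof -
    obtain f where "f \<in> G" "f x0 = x"
      using transitive[OF x] by blast
    then show ?thesis
      using class_image[of f x0] by (auto intro!: card_image inj_on_subset[OF inj_mem])
  qed
  have lambda: "card {B \<in> ?\<B>. T \<subseteq> B} = l" if T: "transversal X E T" "card T = t" for T
  proof -
    obtain f where "f \<in> G" "f ` T0 = T"
      using homogeneous[OF T] by blast
    then show ?thesis
      using card_blocks_through_image[of f B0 T0] by (simp add: l_def)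
  qed
  have B0_sub: "B0 \<subseteq> X"
    using B0 by (simp add: transversal_def)
  obtain T where T: "T \<subseteq> B0" "card T = t"
    using obtain_subset_with_card_n[OF \<open>t \<le> card B0\<close>] by blast
  have T_transversal: "transversal X E T"
    using B0 T(1) by (auto simp: transversal_iff_inequivalent[OF equiv_E])
  have "?\<B> \<subseteq> Pow X"
    using blocks by (auto simp: transversal_def)
  then have "finite {B \<in> ?\<B>. T \<subseteq> B}"
    using finite_X by (auto intro: rev_finite_subset[of "Pow X"])
  then have l_pos: "l > 0"
    using lambda[OF T_transversal T(2)] B0_mem T(1) by (metis (mono_tags, lifting) card_gt_0_iff empty_iff mem_Collect_eq)
  have class_pos: "card (E `` {x0}) > 0"
  proof -
    obtain x where x: "x \<in> X"
      using B0_sub \<open>0 < t\<close> \<open>t \<le> card B0\<close> by fastforce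
    then have "x \<in> E `` {x}"
      using equiv_class_self[OF equiv_E] by blast
    moreover have "finite (E `` {x})"
      using finite_X equiv_E by (meson equiv_type finite_subset Image_subset)
    ultimately show ?thesis
      using classes[OF x] by (metis card_gt_0_iff empty_iff)
  qed
  have t_le: "real t \<le> real (card X) / real (card (E `` {x0}))"
  proof -
    have "t * card (E `` {x0}) \<le> card X"
      using card_transversal_times_class_le[OF T_transversal classes] T(2) by simp
    then show ?thesis
      using class_pos by (simp add: pos_le_divide_eq flip: of_nat_mult)
  qed
  have "0 < card B0"
    using \<open>0 < t\<close> \<open>t \<le> card B0\<close> by linarith
  moreover have "\<forall>B\<in>?\<B>. transversal X E B \<and> card B = card B0"
    using blocks by blast
  moreover have "\<forall>x\<in>X. card (E `` {x}) = card (E `` {x0})"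
    using classes by blast
  moreover have "\<forall>T. transversal X E T \<and> card T = t \<longrightarrow> card {B \<in> ?\<B>. T \<subseteq> B} = l"
    using lambda by blast
  ultimately have "divisible_design t (card (E `` {x0})) (card B0) l X ?\<B> E"
    unfolding divisible_design_def
    using finite_X equiv_E \<open>0 < t\<close> class_pos l_pos t_le by (intro conjI)
  then show ?thesis ..
qed

end

section \<open>Units of a local ring\<close>

text \<open>
  A product with a nonunit factor lies in the ideal of nonunits, so it cannot be \<open>1\<close>. One-sided
  inverses are therefore enough to recognise units, which makes single entries of a matrix
  equation \<open>g ** h = mat 1\<close> useful.
\<close>

lemma unit_if_mult_eq_one:
  assumes "local_ring TYPE('a::ring_1)" "x * y = (1::'a)"
  shows "x \<in> ring_units" "y \<in> ring_units"
proof -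
  have "x * y \<in> ring_units"
    by (simp add: assms(2) ring_units_def)
  then show "x \<in> ring_units" "y \<in> ring_units"
    using assms(1) unfolding local_ring_def two_sided_ideal_def left_ideal_def by blast+
qed

lemma unit_if_sum_eq_one:
  assumes "local_ring TYPE('a::ring_1)" "x + y = (1::'a)"
  shows "x \<in> ring_units \<or> y \<in> ring_units"
proof (rule ccontr)
  assume *: "\<not> (x \<in> ring_units \<or> y \<in> ring_units)"
  have "(1::'a) \<in> ring_units"
    by (auto simp: ring_units_def)
  moreover have "x - (0 - y) \<in> - ring_units"
    using assms(1) * unfolding local_ring_def two_sided_ideal_def left_ideal_def by blast
  ultimately show False
    using assms(2) by simp
qed

lemma nonunit_diff:
  assumes "local_ring TYPE('a::ring_1)" "x \<notin> ring_units" "y \<notin> ring_units"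
  shows "x - (y::'a) \<notin> ring_units"
  using assms unfolding local_ring_def two_sided_ideal_def left_ideal_def by blast

section \<open>The projective line in coordinates\<close>

text \<open>
  This is the submodule written \<open>R(a,b)\<close> in the explanations; it is a point of the projective line
  only for suitable \<open>a\<close> and \<open>b\<close>.
\<close>

abbreviation pt :: "'a::ring_1 \<Rightarrow> 'a \<Rightarrow> ('a ^ 2) set" where
  "pt a b \<equiv> left_span (vector [a, b])"

abbreviation mat2 :: "'a::ring_1 \<Rightarrow> 'a \<Rightarrow> 'a \<Rightarrow> 'a \<Rightarrow> 'a ^ 2 ^ 2" where
  "mat2 a b c d \<equiv> vector [vector [a, b], vector [c, d]]"

lemma mat2_eta: "g = mat2 (g $ 1 $ 1) (g $ 1 $ 2) (g $ 2 $ 1) (g $ 2 $ 2)"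
  by (simp add: vec_eq_iff forall_2)

lemma mat2_mult:
  "mat2 a b c d ** mat2 e f g h = mat2 (a*e + b*g) (a*f + b*h) (c*e + d*g) (c*f + d*h)"
  by (simp add: vec_eq_iff forall_2 matrix_matrix_mult_def sum_2)

lemma mat2_one: "mat 1 = mat2 1 0 0 1"
  by (simp add: vec_eq_iff forall_2 mat_def)

lemma mat2_eq_iff: "mat2 a b c d = mat2 e f g h \<longleftrightarrow> a = e \<and> b = f \<and> c = g \<and> d = h"
  by (auto simp: vec_eq_iff forall_2)

lemma GL2_mult: "g \<in> GL2 \<Longrightarrow> h \<in> GL2 \<Longrightarrow> g ** h \<in> GL2"
  by (simp add: GL2_def invertible_mult)

lemma GL2_one: "mat 1 \<in> GL2"
  by (auto simp: GL2_def invertible_def intro: exI[of _ "mat 1"])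

lemma GL2_inverse: "g \<in> GL2 \<Longrightarrow> \<exists>h\<in>GL2. g ** h = mat 1 \<and> h ** g = mat 1"
  by (auto simp: GL2_def invertible_def)

lemma GL2_I:
  assumes "mat2 a b c d ** mat2 e f g h = mat 1" "mat2 e f g h ** mat2 a b c d = mat 1"
  shows "mat2 a b c d \<in> GL2"
  using assms by (auto simp: GL2_def invertible_def)

lemma act_mult: "act (act p g) h = act p (g ** h)"
  by (simp add: act_def image_image vector_matrix_mul_assoc)

lemma act_one: "act p (mat 1) = p"
  by (simp add: act_def)

lemma act_left_span: "act (left_span v) g = left_span (v v* g)"
proof -
  have "(r *s v) v* g = r *s (v v* g)" for r
    by (simp add: vec_eq_iff vector_matrix_mult_def sum_distrib_left mult.assoc)
  then show ?thesis
    by (simp add: act_def left_span_def image_image)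
qed

lemma act_pt_mat2: "act (pt x y) (mat2 a b c d) = pt (x*a + y*c) (x*b + y*d)"
proof -
  have "vector [x, y] v* mat2 a b c d = vector [x*a + y*c, x*b + y*d]"
    by (simp add: vec_eq_iff forall_2 vector_matrix_mult_def sum_2)
  then show ?thesis
    by (simp add: act_left_span)
qed

lemma pt_eqD:
  assumes "pt a b = pt c d"
  shows "\<exists>r. a = r * c \<and> b = r * d"
proof -
  have "1 *s vector [a, b] \<in> pt a b"
    unfolding left_span_def by blast
  then have "vector [a, b] \<in> pt c d"
    using assms by simp
  then show ?thesis
    by (auto simp: left_span_def vec_eq_iff forall_2)
qed

lemma pt_eqI:
  assumes "a = r * c" "b = r * d" "c = s * a" "d = s * b"
  shows "pt a b = pt c d"
proof -
  have sub: "pt (r * c) (r * d) \<subseteq> pt c d" for r c d :: 'a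
  proof -
    have "q *s vector [r * c, r * d] = (q * r) *s (vector [c, d] :: 'a ^ 2)" for q
      by (simp only: vec_eq_iff) (simp add: forall_2 mult.assoc)
    then show ?thesis
      by (auto simp: left_span_def)
  qed
  show ?thesis
  proof
    show "pt a b \<subseteq> pt c d"
      using sub[of r c d] by (simp only: assms(1,2))
    show "pt c d \<subseteq> pt a b"
      using sub[of s a b] by (simp only: assms(3,4))
  qed
qed

lemma pt_unit_mult:
  assumes "u * w = 1" "w * u = 1"
  shows "pt (u * a) (u * b) = pt a b"
  by (rule pt_eqI[of _ u _ _ _ w]) (simp_all add: assms flip: mult.assoc)

lemma projective_line_act: "p \<in> projective_line \<Longrightarrow> g \<in> GL2 \<Longrightarrow> act p g \<in> projective_line"
  unfolding projective_line_def using GL2_mult by (fastforce simp: act_mult)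

lemma distant_act: "(p, q) \<in> distant \<Longrightarrow> g \<in> GL2 \<Longrightarrow> (act p g, act q g) \<in> distant"
  unfolding distant_def using GL2_mult by (fastforce simp: act_mult)

lemma distant_act_iff:
  assumes "g \<in> GL2"
  shows "(act p g, act q g) \<in> distant \<longleftrightarrow> (p, q) \<in> distant"
proof -
  obtain h where "h \<in> GL2" "g ** h = mat 1"
    using GL2_inverse[OF assms] by blast
  then show ?thesis
    using distant_act[of "act p g" "act q g" h] distant_act[OF _ assms]
    by (auto simp: act_mult act_one)
qed

lemma swap_GL2: "mat2 0 1 1 0 \<in> GL2"
  by (rule GL2_I[of _ _ _ _ 0 1 1 0]) (simp_all add: mat2_mult mat2_one)

text \<open>
  The matrix that exchanges the coordinates exchanges \<open>R(1,0)\<close> and \<open>R(0,1)\<close>.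
\<close>

lemma distant_sym:
  assumes "(p, q) \<in> distant"
  shows "(q, p) \<in> distant"
proof -
  obtain g where g: "g \<in> GL2" and "p = act (pt 1 0) g" "q = act (pt 0 1) g"
    using assms by (auto simp: distant_def)
  then have "p = act (pt 0 1) (mat2 0 1 1 0 ** g)" "q = act (pt 1 0) (mat2 0 1 1 0 ** g)"
    by (simp_all add: act_pt_mat2 flip: act_mult)
  then show ?thesis
    unfolding distant_def using GL2_mult[OF swap_GL2 g] by blast
qed

lemma pt_one_left_in_projective_line: "pt 1 b \<in> projective_line"
proof -
  have "mat2 1 b 0 1 \<in> GL2"
    by (rule GL2_I[of _ _ _ _ 1 "-b" 0 1]) (simp_all add: mat2_mult mat2_one)
  then have "act (pt 1 0) (mat2 1 b 0 1) \<in> projective_line"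
    unfolding projective_line_def by blast
  then show ?thesis
    by (simp add: act_pt_mat2)
qed

lemma pt_one_right_in_projective_line: "pt a 1 \<in> projective_line"
  using projective_line_act[OF pt_one_left_in_projective_line[of a] swap_GL2] by (simp add: act_pt_mat2)

text \<open>
  If the first row of an invertible matrix is \<open>(a, b)\<close>, its product with the first column of the
  inverse has the form \<open>a * e + b * x = 1\<close>. The nonunits form an ideal, so \<open>a\<close> or \<open>b\<close> is a unit and
  the row can be normalised by multiplying with its inverse from the left.
\<close>

lemma projective_line_cases:
  fixes p :: "('a::ring_1 ^ 2) set"
  assumes "local_ring TYPE('a)" "p \<in> projective_line"
  obtains (affine) b where "p = pt 1 b"
  | (infinite) a where "a \<notin> ring_units" "p = pt a 1"
proof -
  obtain g :: "'a^2^2" where g: "g \<in> GL2" and p: "p = act (pt 1 0) g"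
    using assms(2) by (auto simp: projective_line_def)
  obtain a b c d where g_eq: "g = mat2 a b c d"
    using mat2_eta by blast
  have p_eq: "p = pt a b"
    using p g_eq by (simp add: act_pt_mat2)
  obtain h where gh: "g ** h = mat 1"
    using GL2_inverse[OF g] by blast
  obtain e f x y where h_eq: "h = mat2 e f x y"
    using mat2_eta by blast
  have "a * e + b * x = 1"
    using gh unfolding g_eq h_eq mat2_mult mat2_one mat2_eq_iff by simp
  then have "a * e \<in> ring_units \<or> b * x \<in> ring_units"
    using unit_if_sum_eq_one[OF assms(1)] by blast
  then have ab: "a \<in> ring_units \<or> b \<in> ring_units"
    using assms(1) unfolding local_ring_def two_sided_ideal_def by blast
  show ?thesis
  proof (cases "a \<in> ring_units")
    case True
    then obtain w where w: "a * w = 1" "w * a = 1"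
      by (auto simp: ring_units_def)
    have "p = pt 1 (w * b)"
      using pt_unit_mult[OF w(2,1), of a b] p_eq w by simp
    then show ?thesis
      by (rule affine)
  next
    case False
    then obtain w where w: "b * w = 1" "w * b = 1"
      using ab by (auto simp: ring_units_def)
    have "p = pt (w * a) 1"
      using pt_unit_mult[OF w(2,1), of a b] p_eq w by simp
    moreover have "w * a \<notin> ring_units"
      using False assms(1) unfolding local_ring_def two_sided_ideal_def left_ideal_def by blast
    ultimately show ?thesis
      using infinite by blast
  qed
qed

lemma pt_one_left_eq_iff: "pt 1 b = pt 1 d \<longleftrightarrow> b = d"
  using pt_eqD[of 1 b 1 d] by auto

lemma pt_one_right_eq_iff: "pt a 1 = pt c 1 \<longleftrightarrow> a = c"
  using pt_eqD[of a 1 c 1] by auto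

text \<open>
  A point of both forms \<open>R(1,b)\<close> and \<open>R(a,1)\<close> has two unit coordinates. For nonunits \<open>a\<close> the two
  families in \<open>projective_line_cases\<close> are thus disjoint.
\<close>

lemma coordinates_units_if_pt_eq:
  assumes "local_ring TYPE('a::ring_1)" "pt 1 b = pt a (1::'a)"
  shows "a \<in> ring_units" "b \<in> ring_units"
proof -
  obtain r where "1 = r * a"
    using pt_eqD[OF assms(2)] by blast
  then show "a \<in> ring_units"
    using unit_if_mult_eq_one[OF assms(1)] by metis
  obtain s where "1 = s * b"
    using pt_eqD[OF assms(2)[symmetric]] by blast
  then show "b \<in> ring_units"
    using unit_if_mult_eq_one[OF assms(1)] by metis
qed

lemma card_projective_line:
  assumes "local_ring TYPE('a::{ring_1,finite})"
  shows "card (projective_line :: ('a ^ 2) set set)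
    = card (UNIV :: 'a set) + card (- ring_units :: 'a set)"
proof -
  let ?A = "range (pt (1::'a))" and ?I = "(\<lambda>a::'a. pt a 1) ` (- ring_units)"
  have "projective_line = ?A \<union> ?I"
  proof (intro equalityI subsetI)
    fix p :: "('a ^ 2) set"
    assume "p \<in> projective_line"
    with assms show "p \<in> ?A \<union> ?I"
      by (cases rule: projective_line_cases) auto
  qed (auto simp: pt_one_left_in_projective_line pt_one_right_in_projective_line)
  moreover have "?A \<inter> ?I = {}"
    using coordinates_units_if_pt_eq[OF assms] by auto
  then have "card (?A \<union> ?I) = card ?A + card ?I"
    by (intro card_Un_disjoint) simp_all
  moreover have "card ?A = card (UNIV :: 'a set)"
    by (rule card_image) (simp add: inj_on_def pt_one_left_eq_iff)
  moreover have "card ?I = card (- ring_units :: 'a set)"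
    by (rule card_image) (simp add: inj_on_def pt_one_right_eq_iff)
  ultimately show ?thesis
    by simp
qed

section \<open>The parallel relation of a local ring\<close>

text \<open>
  If a matrix maps \<open>R(1,0)\<close> to itself, its upper right entry is \<open>0\<close>. Multiplying it from the left
  by its inverse then shows that the lower right entry is a unit, and this entry is the second
  coordinate of the image of \<open>R(0,1)\<close>.
\<close>

lemma distant_from_base_iff:
  assumes "local_ring TYPE('a::ring_1)"
  shows "(pt 1 0, p) \<in> distant \<longleftrightarrow> (\<exists>c::'a. p = pt c 1)"
proof
  assume "(pt 1 0, p) \<in> distant"
  then obtain g :: "'a^2^2" where g: "g \<in> GL2" and g1: "pt 1 0 = act (pt 1 0) g"
    and p: "p = act (pt 0 1) g"
    by (auto simp: distant_def)
  obtain a b c d where g_eq: "g = mat2 a b c d"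
    using mat2_eta by blast
  obtain r where "b = r * 0"
    using pt_eqD[of a b 1 0] g1 by (auto simp: g_eq act_pt_mat2)
  then have b: "b = 0"
    by simp
  obtain h where gh: "g ** h = mat 1" and hg: "h ** g = mat 1"
    using GL2_inverse[OF g] by blast
  obtain e f x y where h_eq: "h = mat2 e f x y"
    using mat2_eta by blast
  have "f * d = 0" "x * b + y * d = 1"
    using hg unfolding g_eq h_eq mat2_mult mat2_one mat2_eq_iff by (simp_all add: b)
  then have yd: "y * d = 1"
    by (simp add: b)
  then have "d \<in> ring_units"
    using unit_if_mult_eq_one[OF assms] by blast
  then obtain w where w: "d * w = 1" "w * d = 1"
    by (auto simp: ring_units_def)
  have "p = pt (w * c) 1"
    using pt_unit_mult[OF w(2,1), of c d] w by (simp add: p g_eq act_pt_mat2)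
  then show "\<exists>c. p = pt c 1"
    by blast
next
  assume "\<exists>c. p = pt c 1"
  then obtain c where p: "p = pt c 1"
    by blast
  have "mat2 1 0 c 1 \<in> GL2"
    by (rule GL2_I[of _ _ _ _ 1 0 "-c" 1]) (simp_all add: mat2_mult mat2_one)
  then have "(act (pt 1 0) (mat2 1 0 c 1), act (pt 0 1) (mat2 1 0 c 1)) \<in> distant"
    unfolding distant_def by blast
  then show "(pt 1 0, p) \<in> distant"
    by (simp add: act_pt_mat2 p)
qed

text \<open>
  This is the description of the points distant from \<open>R(1,0)\<close>, transported by the exchange of
  coordinates.
\<close>

lemma distant_from_opposite_iff:
  assumes "local_ring TYPE('a::ring_1)"
  shows "(pt 0 1, p) \<in> distant \<longleftrightarrow> (\<exists>d::'a. p = pt 1 d)"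
proof -
  let ?J = "mat2 0 1 1 0 :: 'a^2^2"
  have J: "act (act q ?J) ?J = q" for q
    by (simp add: act_mult mat2_mult act_one flip: mat2_one)
  have "(pt 0 1, p) \<in> distant \<longleftrightarrow> (pt 1 0, act p ?J) \<in> distant"
    using distant_act_iff[OF swap_GL2, of "pt 0 1" p] by (simp add: act_pt_mat2)
  also have "\<dots> \<longleftrightarrow> (\<exists>c. act p ?J = pt c 1)"
    by (rule distant_from_base_iff[OF assms])
  also have "\<dots> \<longleftrightarrow> (\<exists>d. p = pt 1 d)"
  proof -
    have "act p ?J = pt c 1 \<longleftrightarrow> p = pt 1 c" for c
      using J[of p] by (auto simp: act_pt_mat2)
    then show ?thesis
      by simp
  qed
  finally show ?thesis .
qed

text \<open>
  A point not of the form \<open>R(c,1)\<close> is \<open>R(1,b)\<close> for some \<open>b\<close>, and \<open>b\<close> is a nonunit because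
  \<open>R(1,b) = R(w,1)\<close> whenever \<open>w\<close> is the inverse of \<open>b\<close>.
\<close>

lemma parallel_class_base:
  assumes "local_ring TYPE('a::ring_1)"
  shows "parallel `` {pt 1 0} = pt 1 ` (- ring_units :: 'a set)"
proof -
  have "(pt 1 0, p) \<in> parallel \<longleftrightarrow> p \<in> pt 1 ` (- ring_units :: 'a set)" for p
  proof
    assume "(pt 1 0, p) \<in> parallel"
    then have p: "p \<in> projective_line" and not_distant: "\<And>c::'a. p \<noteq> pt c 1"
      by (auto simp: parallel_def distant_from_base_iff[OF assms])
    from assms p show "p \<in> pt 1 ` (- ring_units :: 'a set)"
    proof (cases rule: projective_line_cases)
      case (affine b)
      have "b \<notin> ring_units"
      proof
        assume "b \<in> ring_units"
        then obtain w where w: "b * w = 1" "w * b = 1"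
          by (auto simp: ring_units_def)
        have "p = pt w 1"
          using pt_unit_mult[OF w(2,1), of 1 b] affine w by simp
        then show False
          using not_distant by blast
      qed
      then show ?thesis
        using affine by blast
    qed (use not_distant in blast)
  next
    assume "p \<in> pt 1 ` (- ring_units :: 'a set)"
    then show "(pt 1 0, p) \<in> parallel"
      using pt_one_left_in_projective_line coordinates_units_if_pt_eq[OF assms]
      by (auto simp: parallel_def distant_from_base_iff[OF assms])
  qed
  then show ?thesis
    by blast
qed

lemma parallel_act: "(p, q) \<in> parallel \<Longrightarrow> g \<in> GL2 \<Longrightarrow> (act p g, act q g) \<in> parallel"
  by (simp add: parallel_def projective_line_act distant_act_iff)

lemma parallel_act_iff:
  assumes "g \<in> GL2"
  shows "(act p g, act q g) \<in> parallel \<longleftrightarrow> (p, q) \<in> parallel"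
proof -
  obtain h where "h \<in> GL2" "g ** h = mat 1"
    using GL2_inverse[OF assms] by blast
  then show ?thesis
    using parallel_act[of "act p g" "act q g" h] parallel_act[OF _ assms]
    by (auto simp: act_mult act_one)
qed

lemma move_to_base:
  assumes "p \<in> projective_line"
  obtains g where "g \<in> GL2" "act p g = pt 1 0"
proof -
  obtain h where "h \<in> GL2" "p = act (pt 1 0) h"
    using assms by (auto simp: projective_line_def)
  moreover obtain g where "g \<in> GL2" "h ** g = mat 1"
    using GL2_inverse[OF \<open>h \<in> GL2\<close>] by blast
  ultimately show ?thesis
    using that by (simp add: act_mult act_one)
qed

lemma parallel_sym: "(p, q) \<in> parallel \<Longrightarrow> (q, p) \<in> parallel"
  using distant_sym by (auto simp: parallel_def)

text \<open>
  The shear that subtracts \<open>b\<close> times the first coordinate from the second moves the two points to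
  \<open>R(1,0)\<close> and \<open>R(1,d-b)\<close>, where \<open>d - b\<close> is again a nonunit. Together with
  \<open>parallel_class_base\<close> this says that any two points parallel to \<open>R(1,0)\<close> are parallel.
\<close>

lemma nonunit_points_parallel:
  fixes b d :: "'a::ring_1"
  assumes "local_ring TYPE('a)" "b \<notin> ring_units" "d \<notin> ring_units"
  shows "(pt 1 b, pt 1 d) \<in> parallel"
proof -
  let ?g = "mat2 1 (-b) 0 1"
  have g: "?g \<in> GL2"
    by (rule GL2_I[of _ _ _ _ 1 b 0 1]) (simp_all add: mat2_mult mat2_one)
  have "pt 1 (d - b) \<in> parallel `` {pt 1 0}"
    using nonunit_diff[OF assms(1,3,2)] by (simp add: parallel_class_base[OF assms(1)])
  then have "(act (pt 1 b) ?g, act (pt 1 d) ?g) \<in> parallel"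
    by (simp add: act_pt_mat2)
  then show ?thesis
    by (simp only: parallel_act_iff[OF g])
qed

text \<open>
  For reflexivity and transitivity, the common point is moved to \<open>R(1,0)\<close>, where
  \<open>nonunit_points_parallel\<close> applies.
\<close>

lemma equiv_parallel:
  assumes "local_ring TYPE('a::ring_1)"
  shows "equiv (projective_line :: ('a ^ 2) set set) parallel"
proof (rule equivI)
  show "(parallel :: ('a ^ 2) set rel) \<subseteq> projective_line \<times> projective_line"
    by (auto simp: parallel_def)
  show "sym (parallel :: ('a ^ 2) set rel)"
    by (rule symI) (rule parallel_sym)
  have zero: "(0::'a) \<notin> ring_units"
    by (simp add: ring_units_def)
  show "refl_on projective_line (parallel :: ('a ^ 2) set rel)"
  proof (rule refl_onI)
    fix p :: "('a ^ 2) set"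
    assume "p \<in> projective_line"
    then obtain g where "g \<in> GL2" "act p g = pt 1 0"
      by (rule move_to_base)
    then show "(p, p) \<in> parallel"
      using nonunit_points_parallel[OF assms zero zero] parallel_act_iff by metis
  qed
  show "trans (parallel :: ('a ^ 2) set rel)"
  proof (rule transI)
    fix p q r :: "('a ^ 2) set"
    assume pq: "(p, q) \<in> parallel" and qr: "(q, r) \<in> parallel"
    then have "q \<in> projective_line"
      by (simp add: parallel_def)
    then obtain g where g: "g \<in> GL2" and q: "act q g = pt 1 0"
      by (rule move_to_base)
    have "act p g \<in> parallel `` {pt 1 0}" "act r g \<in> parallel `` {pt 1 0}"
      using parallel_act[OF parallel_sym[OF pq] g] parallel_act[OF qr g] q by auto
    then have "(act p g, act r g) \<in> parallel"
      using nonunit_points_parallel[OF assms] by (auto simp: parallel_class_base[OF assms])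
    then show "(p, r) \<in> parallel"
      by (simp only: parallel_act_iff[OF g])
  qed
qed

section \<open>Transitivity on triples\<close>

text \<open>
  Once \<open>p\<close> and \<open>q\<close> are moved to \<open>R(1,0)\<close> and \<open>R(0,1)\<close>, the image of \<open>r\<close> can be written both as
  \<open>R(c,1)\<close> and as \<open>R(1,d)\<close>, so \<open>d\<close> is a unit. The group still has the diagonal matrices to
  spare, and \<open>diag(1,d)\<close> adjusts the third point.
\<close>

lemma GL2_transitive_on_distant_triples:
  fixes p q r :: "('a::ring_1 ^ 2) set"
  assumes "local_ring TYPE('a)" "(p, q) \<in> distant" "(p, r) \<in> distant" "(q, r) \<in> distant"
  obtains g where "g \<in> GL2" "act (pt 1 0) g = p" "act (pt 0 1) g = q" "act (pt 1 1) g = r"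
proof -
  obtain g where g: "g \<in> GL2" and p: "p = act (pt 1 0) g" and q: "q = act (pt 0 1) g"
    using assms(2) by (auto simp: distant_def)
  obtain h where h: "h \<in> GL2" "g ** h = mat 1" "h ** g = mat 1"
    using GL2_inverse[OF g] by blast
  have "(pt 1 0, act r h) \<in> distant" "(pt 0 1, act r h) \<in> distant"
    using distant_act[OF assms(3) h(1)] distant_act[OF assms(4) h(1)] p q h(2)
    by (simp_all add: act_mult act_one)
  then obtain c d where c: "act r h = pt c 1" and d: "act r h = pt 1 d"
    by (auto simp: distant_from_base_iff[OF assms(1)] distant_from_opposite_iff[OF assms(1)])
  then have "d \<in> ring_units"
    using coordinates_units_if_pt_eq[OF assms(1)] by metis
  then obtain w where w: "d * w = 1" "w * d = 1"
    by (auto simp: ring_units_def)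
  let ?D = "mat2 1 0 0 d"
  have D: "?D \<in> GL2"
    by (rule GL2_I[of _ _ _ _ 1 0 0 w]) (simp_all add: mat2_mult mat2_one w)
  have "pt 0 d = pt 0 1"
    using pt_unit_mult[OF w, of 0 1] by simp
  then have "act (pt 0 1) (?D ** g) = q" "act (pt 1 0) (?D ** g) = p"
    by (simp_all add: act_pt_mat2 p q flip: act_mult)
  moreover have "act (pt 1 1) (?D ** g) = act (act r h) g"
    by (simp add: act_pt_mat2 d flip: act_mult)
  then have "act (pt 1 1) (?D ** g) = r"
    by (simp add: act_mult h act_one)
  ultimately show ?thesis
    using that GL2_mult[OF D g] by blast
qed

theorem theorem4p1p2:
  fixes B0 :: "('a::{ring_1,finite} ^ 2) set set" and k :: nat
  assumes "local_ring TYPE('a)"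
    and "transversal projective_line parallel B0"
    and "card B0 = k"
    and "k \<ge> 3"
  shows "(\<exists>l. divisible_design 3 (card (jacobson_radical :: 'a set)) k l
                (projective_line :: ('a ^ 2) set set) (block_orbit B0) parallel)
       \<and> card (projective_line :: ('a ^ 2) set set)
           = card (UNIV :: 'a set) + card (jacobson_radical :: 'a set)"
proof
  note eq = equiv_parallel[OF assms(1)]
  let ?G = "{\<lambda>p :: ('a ^ 2) set. act p g | g. g \<in> GL2}"
  interpret equivalence_automorphism_group "projective_line :: ('a ^ 2) set set" parallel ?G
  proof
    show "id \<in> ?G"
      using GL2_one by (force simp: fun_eq_iff act_one)
    show "f \<circ> g \<in> ?G" if fg: "f \<in> ?G" "g \<in> ?G" for f g
    proof -
      obtain m n where mn: "m \<in> GL2" "n \<in> GL2" and "f = (\<lambda>p. act p m)" "g = (\<lambda>p. act p n)"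
        using fg by blast
      then have "f \<circ> g = (\<lambda>p. act p (n ** m))"
        by (simp add: fun_eq_iff act_mult)
      then show ?thesis
        using GL2_mult[OF mn(2,1)] by blast
    qed
    show "\<exists>g\<in>?G. g \<circ> f = id \<and> f \<circ> g = id" if f: "f \<in> ?G" for f
    proof -
      obtain m where "m \<in> GL2" and f_eq: "f = (\<lambda>p. act p m)"
        using f by blast
      then obtain n where "n \<in> GL2" "m ** n = mat 1" "n ** m = mat 1"
        using GL2_inverse by blast
      then show ?thesis
        by (intro bexI[of _ "\<lambda>p. act p n"]) (auto simp: f_eq fun_eq_iff act_mult act_one)
    qed
    show "(f x, f y) \<in> parallel" if "f \<in> ?G" "(x, y) \<in> parallel" for f x y
      using that parallel_act by blast
  qed (simp_all add: eq)
  have "\<exists>l. divisible_design 3 (card (parallel `` {pt 1 (0::'a)})) (card B0) l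
      projective_line {f ` B0 |f. f \<in> ?G} parallel"
  proof (rule orbit_is_divisible_design)
    show "\<exists>f\<in>?G. f (pt 1 0) = p" if "p \<in> projective_line" for p
      using that by (auto simp: projective_line_def)
    show "\<exists>f\<in>?G. f ` {pt 1 0, pt 0 1, pt 1 1} = T"
      if T: "transversal projective_line parallel T" "card T = 3" for T
    proof -
      obtain p q r where T_eq: "T = {p, q, r}" and neq: "p \<noteq> q" "q \<noteq> r" "p \<noteq> r"
        using T(2) by (auto simp: card_3_iff)
      have T_sub: "T \<subseteq> projective_line"
        and inequivalent: "\<forall>x\<in>T. \<forall>y\<in>T. (x, y) \<in> parallel \<longrightarrow> x = y"
        using T(1) by (simp_all add: transversal_iff_inequivalent[OF eq])
      have "(x, y) \<in> distant" if "x \<in> T" "y \<in> T" "x \<noteq> y" for x y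
        using that T_sub inequivalent unfolding parallel_def by blast
      then have "(p, q) \<in> distant" "(p, r) \<in> distant" "(q, r) \<in> distant"
        using neq by (simp_all add: T_eq)
      then obtain g where "g \<in> GL2" "act (pt 1 0) g = p" "act (pt 0 1) g = q" "act (pt 1 1) g = r"
        by (rule GL2_transitive_on_distant_triples[OF assms(1)])
      then show ?thesis
        by (intro bexI[of _ "\<lambda>p. act p g"]) (auto simp: T_eq)
    qed
  qed (use assms in simp_all)
  moreover have "{f ` B0 |f. f \<in> ?G} = block_orbit B0"
    by (auto simp: block_orbit_def)
  moreover have "card (parallel `` {pt 1 (0::'a)}) = card (jacobson_radical :: 'a set)"
    unfolding parallel_class_base[OF assms(1)] jacobson_radical_local_ring[OF assms(1)]
    by (rule card_image) (simp add: inj_on_def pt_one_left_eq_iff)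
  ultimately show "\<exists>l. divisible_design 3 (card (jacobson_radical :: 'a set)) k l
      (projective_line :: ('a ^ 2) set set) (block_orbit B0) parallel"
    using assms(3) by simp
  show "card (projective_line :: ('a ^ 2) set set)
      = card (UNIV :: 'a set) + card (jacobson_radical :: 'a set)"
    using card_projective_line[OF assms(1)] jacobson_radical_local_ring[OF assms(1)] by simp
qed

end
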